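(* Let $\Omega\subset\mathbb{R}^2$ be a domain with boundary $\partial\Omega=\partial\Omega_+\cup\partial\Omega_-$, and let $\mu:\bar\Omega\to\bar\Omega$ be a continuous map with $\mu^2=\mathrm{id}$ and $\mu(\partial\Omega_+)=\partial\Omega_-$. Let $G=(V,E)$ be a finite graph with $V=I\cup B$ (disjoint union of interior and boundary vertices), embedded in $\bar\Omega$ by points $x_i$ in the interior of $\Omega$ for $i\in I$ and $x_b\in\partial\Omega$ for $b\in B$. Let $f=(f_b)_{b\in B}$ be the boundary condition with $f_b=1$ if $x_b\in\partial\Omega_+$ and $f_b=-1$ if $x_b\in\partial\Omega_-$. Let $\beta>0$ and let $p_{\mathrm{V}}$ be the Ising distribution on $\{-1,+1\}^I$ with boundary condition $f$, $$p_{\mathrm{V}}(s)\propto \exp\Big(\beta\sum_{ij\in E}s_is_j+\beta\sum_{ib\in E}s_if_b\Big).$$ Let $m:I\to I$ be an involution, $m^2=\mathrm{id}$, and let $P_{\mathrm{MDF}}$ be the transition matrix of the Metropolized double flip move associated with $m$. Then the Metropolized double flip move satisfies detailed balance with respect to $p_{\mathrm{V}}$: for all $s,t\in\{-1,+1\}^I$, $$p_{\mathrm{V}}(s)\,P_{\mathrm{MDF}}(s,t)=p_{\mathrm{V}}(t)\,P_{\mathrm{MDF}}(t,s).$$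
   Context: The graph is simple and undirected. Every edge is either an interior edge $ij$ with $i,j\in I$, or an edge $ib$ joining an interior vertex $i\in I$ to a boundary vertex $b\in B$; the letters $i,j$ always denote vertices of $I$ and $b$ a vertex of $B$. Thus $\sum_{ij\in E}$ is the sum over interior edges (each unordered edge counted once) and $\sum_{ib\in E}$ the sum over interior-boundary edges. A spin configuration is $s=(s_i)_{i\in I}\in\{-1,+1\}^I$, and $\propto$ means equality up to the normalization constant making $p_{\mathrm{V}}$ a probability distribution on $\{-1,+1\}^I$. Metropolized double flip move, from the current configuration $s$: (1) define the proposal $t'$ by $t'_i=-s_{m(i)}$ for all $i\in I$; (2) let $c=\min(1,p_{\mathrm{V}}(t')/p_{\mathrm{V}}(s))$; (3) sample $u\in[0,1]$ uniformly; if $u\le c$ the new configuration is $t'$, otherwise the new configuration is $s$. $P_{\mathrm{MDF}}(s,t)$ is the probability that the new configuration is $t$; that is, $P_{\mathrm{MDF}}(s,t)=c\,\mathbf{1}[t=t']+(1-c)\,\mathbf{1}[t=s]$, where $t'$ and $c$ are determined by $s$ through $t'_i=-s_{m(i)}$ for all $i\in I$ and $c=\min(1,p_{\mathrm{V}}(t')/p_{\mathrm{V}}(s))$. *)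

theory Defs
  imports "HOL-Analysis.Analysis"
begin

definition spin_configs :: "'v set \<Rightarrow> ('v \<Rightarrow> real) set" where
  "spin_configs I = (I \<rightarrow>\<^sub>E {-1, 1})"

definition simple_graph_on :: "'v set \<Rightarrow> 'v set \<Rightarrow> 'v set set \<Rightarrow> bool" where
  "simple_graph_on I B E \<longleftrightarrow>
     (\<forall>e\<in>E. (\<exists>i\<in>I. \<exists>j\<in>I. i \<noteq> j \<and> e = {i, j}) \<or> (\<exists>i\<in>I. \<exists>b\<in>B. e = {i, b}))"

text \<open>The product of the spins over the two-element set \<open>{i, j}\<close> is \<open>s i * s j\<close>, so that
  every unordered interior edge contributes exactly once to the first sum. When \<open>I\<close> and \<open>B\<close> are
  disjoint, the pairs in the second sum correspond one-to-one to the edges between \<open>I\<close> and \<open>B\<close>.\<close>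

definition ising_weight ::
  "'v set \<Rightarrow> 'v set \<Rightarrow> 'v set set \<Rightarrow> real \<Rightarrow> ('v \<Rightarrow> real) \<Rightarrow> ('v \<Rightarrow> real) \<Rightarrow> real" where
  "ising_weight I B E \<beta> f s =
     exp (\<beta> * (\<Sum>e\<in>{e\<in>E. e \<subseteq> I}. \<Prod>v\<in>e. s v)
        + \<beta> * (\<Sum>(i, b)\<in>{(i, b). i \<in> I \<and> b \<in> B \<and> {i, b} \<in> E}. s i * f b))"

definition ising_dist ::
  "'v set \<Rightarrow> 'v set \<Rightarrow> 'v set set \<Rightarrow> real \<Rightarrow> ('v \<Rightarrow> real) \<Rightarrow> ('v \<Rightarrow> real) \<Rightarrow> real" where
  "ising_dist I B E \<beta> f s =
     ising_weight I B E \<beta> f s / (\<Sum>r\<in>spin_configs I. ising_weight I B E \<beta> f r)"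

definition double_flip :: "'v set \<Rightarrow> ('v \<Rightarrow> 'v) \<Rightarrow> ('v \<Rightarrow> real) \<Rightarrow> ('v \<Rightarrow> real)" where
  "double_flip I m s = (\<lambda>i\<in>I. - s (m i))"

definition mdf_accept ::
  "'v set \<Rightarrow> ('v \<Rightarrow> 'v) \<Rightarrow> (('v \<Rightarrow> real) \<Rightarrow> real) \<Rightarrow> ('v \<Rightarrow> real) \<Rightarrow> real" where
  "mdf_accept I m p s = min 1 (p (double_flip I m s) / p s)"

definition mdf_prob ::
  "'v set \<Rightarrow> ('v \<Rightarrow> 'v) \<Rightarrow> (('v \<Rightarrow> real) \<Rightarrow> real) \<Rightarrow> ('v \<Rightarrow> real) \<Rightarrow> ('v \<Rightarrow> real) \<Rightarrow> real" where
  "mdf_prob I m p s t =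
     mdf_accept I m p s * of_bool (t = double_flip I m s)
     + (1 - mdf_accept I m p s) * of_bool (t = s)"

text \<open>The next two facts tie the definitions to the model: \<open>ising_dist\<close> is normalized, and
  \<open>mdf_prob\<close> is the probability, over \<open>u\<close> uniform in \<open>[0, 1]\<close>, that the move ends in \<open>t\<close>.\<close>

lemma sum_ising_dist:
  assumes "finite I"
  shows "(\<Sum>s\<in>spin_configs I. ising_dist I B E \<beta> f s) = 1"
proof -
  have "finite (spin_configs I)"
    unfolding spin_configs_def using assms by (intro finite_PiE) auto
  moreover have "spin_configs I \<noteq> {}"
    unfolding spin_configs_def by (simp add: PiE_eq_empty_iff)
  ultimately have "(\<Sum>r\<in>spin_configs I. ising_weight I B E \<beta> f r) > 0"
    by (intro sum_pos) (auto simp: ising_weight_def)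
  then show ?thesis
    by (simp add: ising_dist_def sum_divide_distrib[symmetric])
qed

lemma mdf_prob_eq_measure:
  assumes "\<And>r. p r \<ge> 0"
  shows "mdf_prob I m p s t =
    measure lborel {u \<in> {0..1}. (if u \<le> mdf_accept I m p s then double_flip I m s else s) = t}"
proof -
  define c where "c = mdf_accept I m p s"
  have c: "0 \<le> c" "c \<le> 1"
    using assms by (auto simp: c_def mdf_accept_def)
  have eq: "{u \<in> {0..1}. (if u \<le> c then double_flip I m s else s) = t} =
     (if t = double_flip I m s then if t = s then {0..1} else {0..c}
      else if t = s then {c<..1} else {})"
    using c by auto
  show ?thesis
    unfolding mdf_prob_def c_def[symmetric] eq using c by auto
qed

end

theory Submission
  imports Defs
begin

text \<open>Flipping all spins and permuting them by an involution is itself an involution on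
  configurations, so the proposal is symmetric. The flow from \<open>s\<close> to \<open>t \<noteq> s\<close> is then
  \<open>p s * min 1 (p t / p s) = min (p s) (p t)\<close>, which is symmetric in \<open>s\<close> and \<open>t\<close>.\<close>

text \<open>The signs cancel and \<open>m\<close> undoes itself on \<open>I\<close>. Outside
  \<open>I\<close> a flipped configuration is \<open>undefined\<close>, so only an extensional
  \<open>s\<close> can be recovered.\<close>

lemma double_flip_double_flip:
  assumes "m \<in> I \<rightarrow> I" "\<forall>i\<in>I. m (m i) = i" "s \<in> extensional I"
  shows "double_flip I m (double_flip I m s) = s"
  using assms by (intro extensionalityI[of _ I]) (auto simp: double_flip_def Pi_iff)

lemma mult_min_1_divide:
  fixes a b :: real
  assumes "a > 0"
  shows "a * min 1 (b / a) = min a b"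
  using assms by (auto simp: min_def field_simps)

lemma mdf_detailed_balance:
  assumes "m \<in> I \<rightarrow> I" "\<forall>i\<in>I. m (m i) = i"
    and "s \<in> extensional I" "t \<in> extensional I"
    and "p s > 0" "p t > 0"
  shows "p s * mdf_prob I m p s t = p t * mdf_prob I m p t s"
proof (cases "t = s")
  case False
  \<comment> \<open>Applying the flip to either equation yields the other.\<close>
  have flip_sym: "t = double_flip I m s \<longleftrightarrow> s = double_flip I m t"
    using assms double_flip_double_flip by metis
  show ?thesis
  proof (cases "t = double_flip I m s")
    case True
    then have "double_flip I m s = t" "double_flip I m t = s"
      using flip_sym by auto
    \<comment> \<open>Since \<open>t\<close> differs from \<open>s\<close>, the rejection terms
      vanish and both sides become \<open>min (p s) (p t)\<close>.\<close>
    then show ?thesis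
      using False assms
      by (simp add: mdf_prob_def mdf_accept_def mult_min_1_divide min.commute)
  next
    case not_flip: False
    \<comment> \<open>Neither configuration is proposed from the other, so both probabilities are
      0.\<close>
    then show ?thesis
      using False flip_sym by (simp add: mdf_prob_def)
  qed
qed simp

text \<open>Positivity makes the acceptance ratio a genuine quotient. Finiteness of \<open>I\<close>
  ensures that the partition function is a finite sum of exponentials; over an infinite set the sum
  would be 0 by convention.\<close>

lemma ising_dist_pos:
  assumes "finite I"
  shows "ising_dist I B E \<beta> f s > 0"
proof -
  have "finite (spin_configs I)" "spin_configs I \<noteq> {}"
    using assms by (auto simp: spin_configs_def PiE_eq_empty_iff intro!: finite_PiE)
  then have "(\<Sum>r\<in>spin_configs I. ising_weight I B E \<beta> f r) > 0"
    by (intro sum_pos) (auto simp: ising_weight_def)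
  then show ?thesis
    by (simp add: ising_dist_def ising_weight_def)
qed

theorem theorem3:
  fixes \<Omega> \<Omega>p \<Omega>m :: "(real ^ 2) set"
    and \<mu> :: "real ^ 2 \<Rightarrow> real ^ 2"
    and V I B :: "'v set" and E :: "'v set set"
    and x :: "'v \<Rightarrow> real ^ 2"
    and f :: "'v \<Rightarrow> real" and \<beta> :: real
    and m :: "'v \<Rightarrow> 'v"
    and s t :: "'v \<Rightarrow> real"
  assumes "open \<Omega>" and "connected \<Omega>" and "\<Omega> \<noteq> {}"
    and "frontier \<Omega> = \<Omega>p \<union> \<Omega>m"
    and "continuous_on (closure \<Omega>) \<mu>"
    and "\<mu> \<in> closure \<Omega> \<rightarrow> closure \<Omega>"
    and "\<forall>z\<in>closure \<Omega>. \<mu> (\<mu> z) = z"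
    and "\<mu> ` \<Omega>p = \<Omega>m"
    and "finite V" and "V = I \<union> B" and "I \<inter> B = {}"
    and "simple_graph_on I B E"
    and "inj_on x V"
    and "\<forall>i\<in>I. x i \<in> interior \<Omega>"
    and "\<forall>b\<in>B. x b \<in> frontier \<Omega>"
    and "\<forall>b\<in>B. (x b \<in> \<Omega>p \<longrightarrow> f b = 1) \<and> (x b \<in> \<Omega>m \<longrightarrow> f b = -1)"
    and "\<beta> > 0"
    and "m \<in> I \<rightarrow> I" and "\<forall>i\<in>I. m (m i) = i"
    and "s \<in> spin_configs I" and "t \<in> spin_configs I"
  shows "ising_dist I B E \<beta> f s * mdf_prob I m (ising_dist I B E \<beta> f) s t
       = ising_dist I B E \<beta> f t * mdf_prob I m (ising_dist I B E \<beta> f) t s"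
proof (rule mdf_detailed_balance)
  have "finite I"
    using assms(9,10) by simp
  then show "ising_dist I B E \<beta> f s > 0" "ising_dist I B E \<beta> f t > 0"
    by (rule ising_dist_pos)+
qed (use assms in \<open>auto simp: spin_configs_def PiE_def\<close>)

end
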